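(* For every computable function $g$, there is no algorithm that, given an $n$-vertex graph $G$ and an integer-valued monotone submodular function $f\colon 2^{V(G)}\rightarrow \mathbb{Z}_{\ge 0}$ represented by a value oracle, computes a cycle $C$ of $G$ with $f(V(C))\le {\sf OPT}$ using at most $g({\sf OPT}) \cdot n^{o(\log {\sf OPT})}$ queries to the oracle.
   Context: A function $f\colon 2^U\to\mathbb{R}$ is submodular if $f(X)+f(Y)\ge f(X\cup Y)+f(X\cap Y)$ for all $X,Y\subseteq U$, and monotone if $f(X)\le f(Y)$ whenever $X\subseteq Y$. The function is accessible only via a value oracle returning $f(X)$ on query $X$. ${\sf OPT}=\min\{f(V(C))\colon C \text{ is a cycle of } G\}$. *)

theory Defs
  imports "HOL-Library.Nat_Bijection" "HOL-Library.Landau_Symbols"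
begin

subsection \<open>Algorithms with an oracle\<close>

text \<open>
  Algorithms are deterministic counter programs over registers holding natural numbers, a
  Turing-complete model, extended by an instruction that sends the content of a register to the
  oracle. In the judgement \<open>exec orc c s qs t\<close>, the list \<open>qs\<close> contains the queries asked during
  the run from \<open>s\<close> to \<open>t\<close>, with repetitions. The program gets stuck on a query outside the
  domain of the oracle.
\<close>

datatype com =
    Inc nat
  | Dec nat
  | Query nat nat
  | Seq com com
  | While nat com

type_synonym state = "nat \<Rightarrow> nat"

inductive exec :: "(nat \<rightharpoonup> nat) \<Rightarrow> com \<Rightarrow> state \<Rightarrow> nat list \<Rightarrow> state \<Rightarrow> bool"
  for orc :: "nat \<rightharpoonup> nat"
where
  Inc: "exec orc (Inc i) s [] (s(i := s i + 1))"
| Dec: "exec orc (Dec i) s [] (s(i := s i - 1))"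
| Query: "orc (s j) = Some a \<Longrightarrow> exec orc (Query i j) s [s j] (s(i := a))"
| Seq: "exec orc c s qs t \<Longrightarrow> exec orc d t qs' u \<Longrightarrow> exec orc (Seq c d) s (qs @ qs') u"
| WhileFalse: "s i = 0 \<Longrightarrow> exec orc (While i c) s [] s"
| WhileTrue: "s i \<noteq> 0 \<Longrightarrow> exec orc c s qs t \<Longrightarrow> exec orc (While i c) t qs' u
    \<Longrightarrow> exec orc (While i c) s (qs @ qs') u"

inductive_cases exec_IncE: "exec orc (Inc i) s qs t"
inductive_cases exec_DecE: "exec orc (Dec i) s qs t"
inductive_cases exec_QueryE: "exec orc (Query i j) s qs t"
inductive_cases exec_SeqE: "exec orc (Seq c d) s qs t"
inductive_cases exec_WhileE: "exec orc (While i c) s qs t"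

lemma exec_deterministic:
  "exec orc c s qs t \<Longrightarrow> exec orc c s qs' t' \<Longrightarrow> qs' = qs \<and> t' = t"
proof (induction arbitrary: qs' t' rule: exec.induct)
  case (Inc i s) then show ?case by (auto elim: exec_IncE)
next
  case (Dec i s) then show ?case by (auto elim: exec_DecE)
next
  case (Query s j a i) then show ?case by (auto elim: exec_QueryE)
next
  case (Seq c s qs t d qs2 u)
  from Seq.prems show ?case by (rule exec_SeqE) (use Seq.IH in blast)
next
  case (WhileFalse s i c) then show ?case by (auto elim: exec_WhileE)
next
  case (WhileTrue s i c qs t qs2 u)
  from WhileTrue.prems show ?case
    by (rule exec_WhileE) (use WhileTrue.IH WhileTrue.hyps in blast)+
qed

definition load :: "nat list \<Rightarrow> state" where
  "load xs = (\<lambda>i. if i < length xs then xs ! i else 0)"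

definition computable :: "(nat \<Rightarrow> nat) \<Rightarrow> bool" where
  "computable g \<longleftrightarrow> (\<exists>c. \<forall>k. \<exists>t. exec Map.empty c (load [k]) [] t \<and> t 0 = g k)"


subsection \<open>Submodular functions and cycles\<close>

definition submodular_on :: "'a set \<Rightarrow> ('a set \<Rightarrow> nat) \<Rightarrow> bool" where
  "submodular_on U f \<longleftrightarrow>
     (\<forall>X\<subseteq>U. \<forall>Y\<subseteq>U. f X + f Y \<ge> f (X \<union> Y) + f (X \<inter> Y))"

text \<open>
  An \<open>n\<close>-vertex graph has the vertex set \<open>{..<n}\<close>, so that it can be input to a program; its
  adjacency relation contains both orientations of every edge.
\<close>

definition simple_graph :: "nat \<Rightarrow> (nat \<times> nat) set \<Rightarrow> bool" where
  "simple_graph n E \<longleftrightarrow> E \<subseteq> {..<n} \<times> {..<n} \<and> sym E \<and> irrefl E"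

definition is_cycle :: "(nat \<times> nat) set \<Rightarrow> nat list \<Rightarrow> bool" where
  "is_cycle E C \<longleftrightarrow> length C \<ge> 3 \<and> distinct C \<and>
     (\<forall>i. Suc i < length C \<longrightarrow> (C ! i, C ! Suc i) \<in> E) \<and> (last C, hd C) \<in> E"

definition OPT :: "(nat \<times> nat) set \<Rightarrow> (nat set \<Rightarrow> nat) \<Rightarrow> nat" where
  "OPT E f = Min {f (set C) | C. is_cycle E C}"

lemma is_cycle_subset:
  assumes "simple_graph n E" "is_cycle E C"
  shows "set C \<subseteq> {..<n}"
proof
  fix v assume "v \<in> set C"
  then obtain i where i: "i < length C" "v = C ! i"
    by (auto simp: in_set_conv_nth)
  have "(v, C ! Suc i) \<in> E \<or> (v, hd C) \<in> E"
  proof (cases "Suc i < length C")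
    case True
    then show ?thesis using assms(2) i by (auto simp: is_cycle_def)
  next
    case False
    then have "i = length C - 1" using i by simp
    then have "v = last C" using i by (metis last_conv_nth length_0_conv less_nat_zero_code)
    then show ?thesis using assms(2) by (simp add: is_cycle_def)
  qed
  then show "v \<in> {..<n}" using assms(1) by (auto simp: simple_graph_def)
qed

lemma finite_cycles:
  assumes "simple_graph n E"
  shows "finite {C. is_cycle E C}"
proof (rule finite_subset)
  show "{C. is_cycle E C} \<subseteq> {C. set C \<subseteq> {..<n} \<and> length C \<le> n}"
  proof safe
    fix C assume C: "is_cycle E C"
    show "v < n" if "v \<in> set C" for v
      using is_cycle_subset[OF assms C] that by auto
    have "length C = card (set C)"
      using C by (simp add: is_cycle_def distinct_card)
    also have "\<dots> \<le> n"
      using card_mono[OF _ is_cycle_subset[OF assms C]] by simp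
    finally show "length C \<le> n" .
  qed
  show "finite {C. set C \<subseteq> {..<n} \<and> length C \<le> n}"
    by (rule finite_lists_length_le) simp
qed

lemma OPT_attained:
  assumes "simple_graph n E" "\<exists>C. is_cycle E C"
  shows "\<exists>C. is_cycle E C \<and> f (set C) = OPT E f"
proof -
  have "{f (set C) | C. is_cycle E C} = (\<lambda>C. f (set C)) ` {C. is_cycle E C}"
    by auto
  then have "OPT E f \<in> (\<lambda>C. f (set C)) ` {C. is_cycle E C}"
    unfolding OPT_def using Min_in finite_cycles[OF assms(1)] assms(2) by auto
  then show ?thesis by auto
qed


subsection \<open>The computational problem\<close>

definition value_oracle :: "nat set \<Rightarrow> (nat set \<Rightarrow> nat) \<Rightarrow> nat \<rightharpoonup> nat" where
  "value_oracle V f q = (if set_decode q \<subseteq> V then Some (f (set_decode q)) else None)"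

definition graph_input :: "nat \<Rightarrow> (nat \<times> nat) set \<Rightarrow> state" where
  "graph_input n E = load [n, set_encode (prod_encode ` E)]"

text \<open>The program halts on the given instance with (the code of) an optimal cycle in register 0,
  after asking at most \<open>b\<close> queries.\<close>

definition finds_optimal_cycle ::
    "com \<Rightarrow> nat \<Rightarrow> (nat \<times> nat) set \<Rightarrow> (nat set \<Rightarrow> nat) \<Rightarrow> real \<Rightarrow> bool" where
  "finds_optimal_cycle c n E f b \<longleftrightarrow>
     (\<exists>qs t C. exec (value_oracle {..<n} f) c (graph_input n E) qs t \<and>
        t 0 = list_encode C \<and> is_cycle E C \<and> f (set C) \<le> OPT E f \<and> real (length qs) \<le> b)"

end

theory Submission
  imports Defs "HOL-Library.FuncSet"
begin

text \<open>
  The vertices are split into \<open>L\<close> layers by their residue modulo \<open>L\<close>, and consecutive layers are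
  joined completely. A cycle either meets every layer exactly once or meets some layer twice. For
  a downward closed family \<open>I\<close> of sets of size at most \<open>L\<close>, the function that is
  \<open>2 ^ L - 2 ^ (L - card X)\<close> on \<open>I\<close> and \<open>2 ^ L\<close> elsewhere is monotone and submodular. If \<open>I\<close> consists
  of the partial transversals of size less than \<open>L\<close>, all cycles cost \<open>2 ^ L\<close>; adding one full
  transversal \<open>S\<close> to \<open>I\<close> lowers only the value at \<open>S\<close>, to \<open>2 ^ L - 1\<close>. So an algorithm has to query
  all but one of the \<open>m ^ L\<close> transversals on \<open>n = m * L\<close> vertices, whereas the allowed number of
  queries is at most a constant times \<open>n powr (L / 2)\<close> when \<open>L\<close> is large.
\<close>

text \<open>A run sees the oracle only through the answers to its listed queries. This lets the
  adversary change the cost of an unqueried set without changing the run.\<close>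

lemma exec_cong_oracle:
  assumes "exec orc c s qs t" "\<And>q. q \<in> set qs \<Longrightarrow> orc' q = orc q"
  shows "exec orc' c s qs t"
  using assms by (induction rule: exec.induct)
    (auto intro: exec.intros exec.Inc[simplified] exec.Dec[simplified])


subsection \<open>Submodular functions from downward closed families\<close>

text \<open>For \<open>card X\<close> up to \<open>L\<close>, the k-th element gained inside
  \<open>I\<close> adds 2^(L-k). Leaving \<open>I\<close> from size k adds all that is missing to
  2^L, again 2^(L-k), so returns never increase.\<close>

definition family_cost :: "nat \<Rightarrow> 'a set set \<Rightarrow> 'a set \<Rightarrow> nat" where
  "family_cost L I X = (if X \<in> I then 2 ^ L - 2 ^ (L - card X) else 2 ^ L)"

text \<open>With a = c + p and b = c + q, dividing by 2^(L-u) turns the claim into (2^p - 1)(2^q -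
  1) \<ge> 0.\<close>

lemma power2_supermodular:
  fixes a b u c L :: nat
  assumes "c \<le> a" "c \<le> b" "u + c = a + b" "u \<le> L"
  shows "(2::nat) ^ (L - a) + 2 ^ (L - b) \<le> 2 ^ (L - u) + 2 ^ (L - c)"
proof -
  obtain p q r where "a = c + p" "b = c + q" "L = u + r"
    using assms by (metis le_iff_add)
  moreover from this have "u = c + p + q" using assms(3) by simp
  ultimately have e: "L - a = r + q" "L - b = r + p" "L - u = r" "L - c = r + p + q" by auto
  obtain x y where "(2::nat) ^ p = Suc x" "(2::nat) ^ q = Suc y"
    by (metis not0_implies_Suc power_not_zero zero_neq_numeral)
  then show ?thesis unfolding e power_add by (simp add: algebra_simps)
qed

text \<open>Each summand is at most half of the right side. This serves the case where X and Y lie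
  in the family but their union does not.\<close>

lemma power2_add_le:
  fixes a b c L :: nat
  assumes "c < a" "c < b" "a \<le> L" "b \<le> L"
  shows "(2::nat) ^ (L - a) + 2 ^ (L - b) \<le> 2 ^ (L - c)"
proof -
  have "(2::nat) ^ (L - a) \<le> 2 ^ (L - Suc c)" "(2::nat) ^ (L - b) \<le> 2 ^ (L - Suc c)"
    using assms by (auto intro!: power_increasing)
  moreover have "(2::nat) ^ (L - c) = 2 * 2 ^ (L - Suc c)"
    using assms by (metis Suc_diff_Suc order_less_le_trans power_Suc)
  ultimately show ?thesis by linarith
qed

context
  fixes L :: nat and I :: "'a set set" and U :: "'a set"
  assumes finite_ground: "finite U"
    and down_closed: "\<And>X Y. Y \<in> I \<Longrightarrow> X \<subseteq> Y \<Longrightarrow> X \<in> I"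
    and card_le: "\<And>X. X \<in> I \<Longrightarrow> card X \<le> L"
begin

text \<open>Working with the complement to 2^L avoids subtraction: cost is monotone and submodular
  once the deficit is antitone and supermodular.\<close>

definition deficit :: "'a set \<Rightarrow> nat" where
  "deficit X = (if X \<in> I then 2 ^ (L - card X) else 0)"

lemma family_cost_deficit: "family_cost L I X + deficit X = 2 ^ L"
  unfolding family_cost_def deficit_def by (simp add: power_increasing)

lemma deficit_antimono:
  assumes "X \<subseteq> Y" "Y \<subseteq> U"
  shows "deficit Y \<le> deficit X"
proof (cases "Y \<in> I")
  case True
  then have "X \<in> I" using down_closed assms by blast
  moreover have "card X \<le> card Y" using assms finite_ground by (meson card_mono finite_subset)
  ultimately show ?thesis using True by (simp add: deficit_def)
qed (simp add: deficit_def)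

lemma deficit_supermodular:
  assumes "X \<subseteq> U" "Y \<subseteq> U"
  shows "deficit X + deficit Y \<le> deficit (X \<union> Y) + deficit (X \<inter> Y)"
proof -
  have fin: "finite X" "finite Y" using assms finite_ground finite_subset by blast+
  have cards: "card (X \<union> Y) + card (X \<inter> Y) = card X + card Y"
    using card_Un_Int[OF fin] by simp
  have mono: "deficit X \<le> deficit (X \<inter> Y)" "deficit Y \<le> deficit (X \<inter> Y)"
    using deficit_antimono assms by blast+
  show ?thesis
  proof (cases "X \<in> I \<and> Y \<in> I")
    case both: True
    then have int: "X \<inter> Y \<in> I" using down_closed by blast
    show ?thesis
    proof (cases "X \<union> Y \<in> I")
      case True
      have "(2::nat) ^ (L - card X) + 2 ^ (L - card Y)
          \<le> 2 ^ (L - card (X \<union> Y)) + 2 ^ (L - card (X \<inter> Y))"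
        using cards fin card_le[OF True]
        by (intro power2_supermodular) (auto intro: card_mono)
      then show ?thesis using True both int by (simp add: deficit_def)
    next
      case False
      \<comment> \<open>If X and Y were comparable, their union would be one of them and hence in
        \<open>I\<close>.\<close>
      then have "X \<inter> Y \<subset> X" "X \<inter> Y \<subset> Y"
        using both by (metis Int_lower1 Int_lower2 Un_absorb1 Un_absorb2 inf.absorb_iff1 inf.absorb_iff2 psubsetI)+
      then have "(2::nat) ^ (L - card X) + 2 ^ (L - card Y) \<le> 2 ^ (L - card (X \<inter> Y))"
        using both fin card_le by (intro power2_add_le) (auto intro: psubset_card_mono)
      then show ?thesis using False both int by (simp add: deficit_def)
    qed
  next
    case False
    \<comment> \<open>The other deficit is at most that of the intersection, by
      antitonicity.\<close>
    then have "deficit X = 0 \<or> deficit Y = 0" by (auto simp: deficit_def)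
    then show ?thesis using mono by auto
  qed
qed

lemma family_cost_mono: "mono_on (Pow U) (family_cost L I)"
proof (rule mono_onI)
  fix X Y assume "X \<in> Pow U" "Y \<in> Pow U" "X \<le> Y"
  then show "family_cost L I X \<le> family_cost L I Y"
    using deficit_antimono[of X Y] family_cost_deficit[of X] family_cost_deficit[of Y] by simp
qed

lemma family_cost_submodular: "submodular_on U (family_cost L I)"
  unfolding submodular_on_def
proof (intro allI impI)
  fix X Y assume "X \<subseteq> U" "Y \<subseteq> U"
  then show "family_cost L I (X \<union> Y) + family_cost L I (X \<inter> Y)
      \<le> family_cost L I X + family_cost L I Y"
    using deficit_supermodular[of X Y] family_cost_deficit[of X] family_cost_deficit[of Y]
      family_cost_deficit[of "X \<union> Y"] family_cost_deficit[of "X \<inter> Y"] by simp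
qed

end


subsection \<open>Cyclically layered graphs\<close>

definition layered_graph :: "nat \<Rightarrow> nat \<Rightarrow> (nat \<times> nat) set" where
  "layered_graph L n =
     {(u, v). u < n \<and> v < n \<and> (v mod L = Suc u mod L \<or> u mod L = Suc v mod L)}"

definition transversal :: "nat \<Rightarrow> (nat \<Rightarrow> nat) \<Rightarrow> nat list" where
  "transversal L \<phi> = map (\<lambda>i. \<phi> i * L + i) [0..<L]"

lemma Suc_mod_neq:
  assumes "2 \<le> (L::nat)"
  shows "Suc v mod L \<noteq> v mod L"
  using assms mod_less_divisor[of L v] by (auto simp: mod_Suc)

lemma Suc_mod_cong:
  "(a::nat) mod L = b mod L \<Longrightarrow> Suc a mod L = Suc b mod L"
  by (metis mod_Suc_eq)

lemma Suc_mod_inj: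
  assumes "Suc a mod L = Suc b mod L"
  shows "(a::nat) mod L = b mod L"
proof -
  have "Suc (a mod L) = L \<longleftrightarrow> Suc (b mod L) = L"
    using assms by (metis mod_Suc nat.distinct(1))
  then show ?thesis using assms by (auto simp: mod_Suc split: if_splits)
qed

lemma layered_graph_simple:
  assumes "2 \<le> L"
  shows "simple_graph n (layered_graph L n)"
  using Suc_mod_neq[OF assms] unfolding simple_graph_def layered_graph_def
  by (auto simp: sym_def irrefl_def) metis+

text \<open>The cyclic predecessor and successor, at positions \<open>p\<close> and
  \<open>q\<close>, are different because the length is at least 3.\<close>

lemma is_cycle_neighbours:
  assumes "is_cycle E C" "v \<in> set C"
  shows "\<exists>u w. u \<in> set C \<and> w \<in> set C \<and> u \<noteq> w \<and> (u, v) \<in> E \<and> (v, w) \<in> E"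
proof -
  define l where "l = length C"
  have l: "3 \<le> l" "distinct C" and step: "\<And>i. Suc i < l \<Longrightarrow> (C ! i, C ! Suc i) \<in> E"
    and "(last C, hd C) \<in> E"
    using assms(1) by (auto simp: is_cycle_def l_def)
  then have close: "(C ! (l - 1), C ! 0) \<in> E"
    by (metis hd_conv_nth l_def last_conv_nth list.size(3) not_numeral_le_zero)
  obtain i where i: "i < l" "v = C ! i" using assms(2) by (auto simp: in_set_conv_nth l_def)
  define p where "p = (if i = 0 then l - 1 else i - 1)"
  define q where "q = (if i = l - 1 then 0 else Suc i)"
  have "p < l" "q < l" "p \<noteq> q" using i l by (auto simp: p_def q_def)
  moreover have "(C ! p, v) \<in> E" using i close step[of "i - 1"] by (auto simp: p_def)
  moreover have "(v, C ! q) \<in> E" using i close step[of i] by (auto simp: q_def)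
  ultimately show ?thesis using l
    by (metis l_def nth_eq_iff_index_eq nth_mem)
qed

text \<open>A cycle with at most one vertex per layer cannot turn back, so it runs through all
  layers.\<close>

lemma layered_cycle_length:
  assumes "2 \<le> L" and C: "is_cycle (layered_graph L n) C" and inj: "inj_on (\<lambda>v. v mod L) (set C)"
  shows "L \<le> card (set C)"
proof -
  have next_layer: "\<exists>w\<in>set C. w mod L = Suc v mod L" if v: "v \<in> set C" for v
  proof (rule ccontr)
    \<comment> \<open>Without a vertex in the next layer, both neighbours of v would lie in the
      previous one, against injectivity.\<close>
    assume none: "\<not> ?thesis"
    obtain u w where uw: "u \<in> set C" "w \<in> set C" "u \<noteq> w"
      "(u, v) \<in> layered_graph L n" "(v, w) \<in> layered_graph L n"
      using is_cycle_neighbours[OF C v] by blast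
    then have "v mod L = Suc u mod L" "v mod L = Suc w mod L"
      using none by (auto simp: layered_graph_def)
    then have "u mod L = w mod L" by (metis Suc_mod_inj)
    then show False using inj uw by (auto dest: inj_onD)
  qed
  obtain v0 where v0: "v0 \<in> set C"
    using C by (metis is_cycle_def last_in_set list.size(3) not_numeral_le_zero)
  have reach: "\<exists>w\<in>set C. w mod L = (v0 + k) mod L" for k
  proof (induction k)
    case (Suc k)
    then obtain w where "w \<in> set C" "w mod L = (v0 + k) mod L" by blast
    then show ?case using next_layer[of w] Suc_mod_cong[of w L "v0 + k"] by auto
  qed (use v0 in auto)
  have "{..<L} \<subseteq> (\<lambda>v. v mod L) ` set C"
  proof
    fix i assume i: "i \<in> {..<L}"
    \<comment> \<open>The multiple \<open>v0 * L\<close> keeps the offset from \<open>v0\<close> to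
      residue i from being truncated.\<close>
    have "v0 \<le> v0 * L" using assms(1) by simp
    then have "v0 + (i + v0 * L - v0) = i + v0 * L" by linarith
    then have "(v0 + (i + v0 * L - v0)) mod L = i" using i by simp
    then show "i \<in> (\<lambda>v. v mod L) ` set C" using reach[of "i + v0 * L - v0"] by force
  qed
  then show ?thesis by (metis List.finite_set card_lessThan surj_card_le)
qed

section \<open>Full transversals: cycles through all layers, and their number\<close>

lemma transversal_set: "set (transversal L \<phi>) = (\<lambda>i. \<phi> i * L + i) ` {..<L}"
  by (auto simp: transversal_def atLeast0LessThan)

lemma transversal_inj: "inj_on (\<lambda>v. v mod L) (set (transversal L \<phi>))"
  by (auto simp: transversal_set inj_on_def)

lemma transversal_distinct: "distinct (transversal L \<phi>)"
proof -
  have "inj_on (\<lambda>i. \<phi> i * L + i) {0..<L}"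
  proof (rule inj_onI)
    fix i j assume "i \<in> {0..<L}" "j \<in> {0..<L}" "\<phi> i * L + i = \<phi> j * L + j"
    then show "i = j"
      by (metis atLeastLessThan_iff mod_less mod_mult_self3)
  qed
  then show ?thesis by (simp add: transversal_def distinct_map)
qed

lemma transversal_card: "card (set (transversal L \<phi>)) = L"
  using distinct_card[OF transversal_distinct] by (simp add: transversal_def)

lemma transversal_less:
  fixes m :: nat
  assumes "\<phi> \<in> {..<L} \<rightarrow> {..<m}" "i < L"
  shows "\<phi> i * L + i < m * L"
proof -
  have "\<phi> i * L + i < Suc (\<phi> i) * L" using assms(2) by simp
  also have "\<dots> \<le> m * L" using assms by (intro mult_le_mono1) (auto simp: Pi_iff Suc_le_eq)
  finally show ?thesis .
qed

lemma transversal_cycle: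
  assumes "3 \<le> L" and \<phi>: "\<phi> \<in> {..<L} \<rightarrow> {..<m}"
  shows "is_cycle (layered_graph L (m * L)) (transversal L \<phi>)"
proof -
  let ?v = "\<lambda>i. \<phi> i * L + i"
  have "(?v i, ?v (Suc i)) \<in> layered_graph L (m * L)" if "Suc i < L" for i
    using that transversal_less[OF \<phi>, of i] transversal_less[OF \<phi>, of "Suc i"]
      Suc_mod_cong[of "?v i" L i] by (auto simp: layered_graph_def)
  \<comment> \<open>The closing edge exists because Suc (L - 1) is 0 modulo L.\<close>
  moreover have "(?v (L - 1), ?v 0) \<in> layered_graph L (m * L)"
    using assms(1) transversal_less[OF \<phi>, of "L - 1"] transversal_less[OF \<phi>, of 0]
      Suc_mod_cong[of "?v (L - 1)" L "L - 1"] by (auto simp: layered_graph_def)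
  moreover have "last (transversal L \<phi>) = ?v (L - 1)" "hd (transversal L \<phi>) = ?v 0"
    using assms(1) by (simp_all add: transversal_def last_map hd_map)
  ultimately show ?thesis
    using assms(1) transversal_distinct[of L \<phi>] by (simp add: is_cycle_def) (simp add: transversal_def)
qed

lemma card_transversals:
  "card ((\<lambda>\<phi>. set (transversal L \<phi>)) ` ({..<L} \<rightarrow>\<^sub>E {..<m})) = m ^ L"
proof -
  have "inj_on (\<lambda>\<phi>. set (transversal L \<phi>)) ({..<L} \<rightarrow>\<^sub>E {..<m})"
  proof (rule inj_onI)
    fix \<phi> \<psi> assume mem: "\<phi> \<in> {..<L} \<rightarrow>\<^sub>E {..<m}" "\<psi> \<in> {..<L} \<rightarrow>\<^sub>E {..<m}"
      and eq: "set (transversal L \<phi>) = set (transversal L \<psi>)"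
    show "\<phi> = \<psi>"
    proof (rule PiE_ext[OF mem])
      fix i assume i: "i \<in> {..<L}"
      then have "\<phi> i * L + i \<in> set (transversal L \<psi>)" using eq by (auto simp: transversal_set)
      then obtain j where j: "j < L" "\<phi> i * L + i = \<psi> j * L + j" by (auto simp: transversal_set)
      \<comment> \<open>The residue modulo L recovers the layer, and then the quotient recovers the
        choice in it.\<close>
      then have "i = j" using i by (metis lessThan_iff mod_less mod_mult_self3)
      then show "\<phi> i = \<psi> i" using j by simp
    qed
  qed
  then show ?thesis by (simp add: card_image card_PiE)
qed


subsection \<open>The adversary\<close>

definition partial_transversals :: "nat \<Rightarrow> nat set set" where
  "partial_transversals L = {X. finite X \<and> inj_on (\<lambda>v. v mod L) X \<and> card X < L}"

lemma partial_transversals_down_closed: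
  "Y \<in> partial_transversals L \<Longrightarrow> X \<subseteq> Y \<Longrightarrow> X \<in> partial_transversals L"
  unfolding partial_transversals_def
  by (auto intro: finite_subset inj_on_subset dest: card_mono)

lemma partial_transversals_card:
  "X \<in> partial_transversals L \<Longrightarrow> card X \<le> L"
  by (simp add: partial_transversals_def)

text \<open>A proper subset of the full transversal has fewer than \<open>L\<close> elements, so it
  is already a partial transversal.\<close>

lemma insert_transversal_down_closed:
  assumes "Y \<in> insert (set (transversal L \<phi>)) (partial_transversals L)" "X \<subseteq> Y"
  shows "X \<in> insert (set (transversal L \<phi>)) (partial_transversals L)"
proof (cases "Y = set (transversal L \<phi>) \<and> X \<noteq> Y")
  case True
  then have "card X < L"
    using psubset_card_mono[of Y X] assms(2) transversal_card[of L \<phi>] by auto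
  then show ?thesis using True assms(2) transversal_inj[of L \<phi>]
    by (auto simp: partial_transversals_def intro: finite_subset inj_on_subset)
qed (use assms partial_transversals_down_closed in auto)

lemma layered_cycle_not_partial:
  assumes "2 \<le> L" "is_cycle (layered_graph L n) C"
  shows "set C \<notin> partial_transversals L"
  using layered_cycle_length[OF assms] by (auto simp: partial_transversals_def)

text \<open>The run on \<open>f0\<close> is replayed on \<open>f1\<close>, which hides one cheaper
  transversal. The extra 1 pays for the set of the output cycle, which must be avoided besides the
  queries.\<close>

lemma query_lower_bound:
  assumes L: "3 \<le> L" and "0 < m"
    and correct: "\<And>f. mono_on (Pow {..<m * L}) f \<Longrightarrow> submodular_on {..<m * L} f \<Longrightarrow>
      finds_optimal_cycle alg (m * L) (layered_graph L (m * L)) f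
        (B (OPT (layered_graph L (m * L)) f))"
  shows "real (m ^ L) \<le> B (2 ^ L) + 1"
proof -
  define n where "n = m * L"
  define E where "E = layered_graph L n"
  define P where "P = partial_transversals L"
  define f0 where "f0 = family_cost L P"
  have correct': "finds_optimal_cycle alg n E f (B (OPT E f))"
    if "mono_on (Pow {..<n}) f" "submodular_on {..<n} f" for f
    using correct that by (simp add: n_def E_def)
  have graph: "simple_graph n E" using layered_graph_simple L by (simp add: E_def)
  have f0_cycle: "f0 (set C) = 2 ^ L" if "is_cycle E C" for C
    using layered_cycle_not_partial[of L n C] that L
    by (simp add: E_def P_def f0_def family_cost_def)
  have "is_cycle E (transversal L (\<lambda>_. 0))"
    unfolding E_def n_def using transversal_cycle[OF L] \<open>0 < m\<close> by simp
  then have OPT0: "OPT E f0 = 2 ^ L"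
    using OPT_attained[OF graph] f0_cycle by metis
  have "finds_optimal_cycle alg n E f0 (B (OPT E f0))"
    unfolding f0_def P_def
    by (intro correct' family_cost_mono family_cost_submodular)
      (auto intro: partial_transversals_down_closed partial_transversals_card)
  then obtain qs t C where run: "exec (value_oracle {..<n} f0) alg (graph_input n E) qs t"
    and out: "t 0 = list_encode C" "is_cycle E C" and len: "real (length qs) \<le> B (2 ^ L)"
    unfolding finds_optimal_cycle_def OPT0 by blast
  show ?thesis
  proof (rule ccontr)
    assume "\<not> ?thesis"
    then have many: "Suc (length qs) < m ^ L"
      using len by (simp flip: of_nat_less_iff[where 'a = real])
    define T where "T = (\<lambda>\<phi>. set (transversal L \<phi>)) ` ({..<L} \<rightarrow>\<^sub>E {..<m})"
    define Q where "Q = insert (set C) (set_decode ` set qs)"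
    have "card Q \<le> Suc (card (set_decode ` set qs))" unfolding Q_def by (rule card_insert_le_m1) auto
    also have "card (set_decode ` set qs) \<le> length qs"
      by (meson List.finite_set card_image_le card_length le_trans)
    finally have "card Q < card T" using many by (simp add: T_def card_transversals)
    then have "\<not> T \<subseteq> Q" using card_mono[of Q T] by (auto simp: Q_def)
    then obtain \<phi> where \<phi>: "\<phi> \<in> {..<L} \<rightarrow>\<^sub>E {..<m}" and unseen: "set (transversal L \<phi>) \<notin> Q"
      by (auto simp: T_def)
    define S where "S = set (transversal L \<phi>)"
    define f1 where "f1 = family_cost L (insert S P)"
    have f1_eq: "f1 X = f0 X" if "X \<noteq> S" for X
      using that by (simp add: f0_def f1_def family_cost_def)
    \<comment> \<open>For \<open>f1\<close> only the optimality of the output is used; the query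
      bound is applied to \<open>f0\<close> alone.\<close>
    have "finds_optimal_cycle alg n E f1 (B (OPT E f1))"
    proof -
      have down: "X \<in> insert S P" if "Y \<in> insert S P" "X \<subseteq> Y" for X Y
        using insert_transversal_down_closed that unfolding S_def P_def .
      have card: "card X \<le> L" if "X \<in> insert S P" for X
        using that by (auto simp: S_def P_def transversal_card partial_transversals_card)
      show ?thesis
        unfolding f1_def using family_cost_mono[OF _ down card] family_cost_submodular[OF _ down card]
        by (intro correct') auto
    qed
    then obtain qs' t' C' where
      run': "exec (value_oracle {..<n} f1) alg (graph_input n E) qs' t'"
      and out': "t' 0 = list_encode C'" "f1 (set C') \<le> OPT E f1"
      unfolding finds_optimal_cycle_def by blast
    have "exec (value_oracle {..<n} f1) alg (graph_input n E) qs t"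
    proof (rule exec_cong_oracle[OF run])
      fix q assume "q \<in> set qs"
      then have "set_decode q \<noteq> S" using unseen by (auto simp: Q_def S_def)
      then show "value_oracle {..<n} f1 q = value_oracle {..<n} f0 q"
        by (simp add: value_oracle_def f1_eq)
    qed
    then have "t' = t" using exec_deterministic run' by blast
    then have "C' = C" using out out' by (simp add: list_encode_eq)
    moreover have "set C \<noteq> S" using unseen by (auto simp: Q_def S_def)
    \<comment> \<open>The unchanged output still costs 2^L under \<open>f1\<close>, while the cycle
      on \<open>S\<close> costs one less.\<close>
    ultimately have "2 ^ L \<le> OPT E f1" using out' f1_eq f0_cycle[OF out(2)] by simp
    also have "OPT E f1 \<le> f1 S"
    proof -
      have "is_cycle E (transversal L \<phi>)"
        unfolding E_def n_def using transversal_cycle[OF L] \<phi> by (auto simp: PiE_iff)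
      moreover have "{f1 (set D) |D. is_cycle E D} = (\<lambda>D. f1 (set D)) ` {D. is_cycle E D}"
        by auto
      ultimately show ?thesis
        unfolding OPT_def S_def using finite_cycles[OF graph] by (auto intro!: Min_le)
    qed
    also have "f1 S = 2 ^ L - 1"
      using transversal_card[of L \<phi>] by (simp add: f1_def family_cost_def S_def)
    finally show False using one_le_power[of "2::nat" L] by linarith
  qed
qed

section \<open>Numerical estimate and choice of parameters\<close>

lemma allowed_queries_less:
  fixes G L r :: nat and d :: real
  assumes "0 < L" "d \<le> real L / 2" "r = G + 2"
  shows "real G * real (L * r\<^sup>2 * L) powr d + 1 < real ((L * r\<^sup>2) ^ L)"
proof -
  have pos: "1 \<le> L * r" using assms by simp
  \<comment> \<open>The number of vertices is the square of L r, so an exponent of at most L/2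
    allows only (L r)^L. The number of transversals has a further factor r^L \<ge> r = G + 2, which
    absorbs both G and the added 1.\<close>
  have sq: "real (L * r\<^sup>2 * L) = real (L * r) powr 2"
    using pos by (simp add: powr_numeral power2_eq_square)
  have "real (L * r\<^sup>2 * L) powr d = real (L * r) powr (2 * d)"
    unfolding sq by (rule powr_powr)
  also have "\<dots> \<le> real (L * r) powr real L"
    using pos assms(2) by (intro powr_mono) (auto simp del: of_nat_mult)
  also have "\<dots> = real ((L * r) ^ L)"
    using pos by (simp add: powr_realpow del: of_nat_mult)
  finally have "real G * real (L * r\<^sup>2 * L) powr d + 1 \<le> real (G * (L * r) ^ L + 1)"
    by (simp add: mult_left_mono del: of_nat_mult of_nat_power) (simp add: mult_left_mono)
  also have "G * (L * r) ^ L + 1 < r * (L * r) ^ L"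
  proof -
    have "1 \<le> (L * r) ^ L" using pos by (rule one_le_power)
    then show ?thesis unfolding assms(3) by (simp only: add_mult_distrib)
  qed
  also have "r * (L * r) ^ L \<le> r ^ L * (L * r) ^ L"
    using assms by (intro mult_right_mono) (auto simp: self_le_power)
  also have "r ^ L * (L * r) ^ L = (L * r\<^sup>2) ^ L"
    by (simp add: power_mult_distrib power2_eq_square)
  finally show ?thesis by simp
qed

theorem theorem3:
  fixes g :: "nat \<Rightarrow> nat"
  assumes "computable g"
  shows "\<not> (\<exists>(alg :: com) (h :: nat \<Rightarrow> real).
           h \<in> o(\<lambda>k. ln (real k)) \<and>
           (\<forall>(n :: nat) (E :: (nat \<times> nat) set) (f :: nat set \<Rightarrow> nat).
              simple_graph n E \<and> (\<exists>C. is_cycle E C) \<and>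
              mono_on (Pow {..<n}) f \<and> submodular_on {..<n} f \<longrightarrow>
              finds_optimal_cycle alg n E f
                (real (g (OPT E f)) * real n powr h (OPT E f))))"
proof
  assume "\<exists>(alg :: com) (h :: nat \<Rightarrow> real).
           h \<in> o(\<lambda>k. ln (real k)) \<and>
           (\<forall>(n :: nat) (E :: (nat \<times> nat) set) (f :: nat set \<Rightarrow> nat).
              simple_graph n E \<and> (\<exists>C. is_cycle E C) \<and>
              mono_on (Pow {..<n}) f \<and> submodular_on {..<n} f \<longrightarrow>
              finds_optimal_cycle alg n E f
                (real (g (OPT E f)) * real n powr h (OPT E f)))"
  then obtain alg h where h: "h \<in> o(\<lambda>k. ln (real k))"
    and correct: "\<And>n E f. simple_graph n E \<Longrightarrow> \<exists>C. is_cycle E C \<Longrightarrow> mono_on (Pow {..<n}) f \<Longrightarrow>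
      submodular_on {..<n} f \<Longrightarrow>
      finds_optimal_cycle alg n E f (real (g (OPT E f)) * real n powr h (OPT E f))"
    by blast
  obtain N where N: "\<And>k. N \<le> k \<Longrightarrow> norm (h k) \<le> 1 / 2 * norm (ln (real k))"
    using landau_o.smallD[OF h, of "1 / 2"] by (auto simp: eventually_sequentially)
  \<comment> \<open>At least 3 for a cycle, and at least \<open>N\<close> so that the bound on
    \<open>h\<close> holds at the optimum 2^L of the base instance. That optimum does not depend on
    \<open>m\<close>, so \<open>m\<close> may be chosen in terms of g(2^L).\<close>
  define L where "L = max 3 N"
  define r where "r = g (2 ^ L) + 2"
  define m where "m = L * r\<^sup>2"
  have L: "3 \<le> L" by (simp add: L_def)
  have m: "0 < m" using L by (simp add: m_def r_def)
  have "N \<le> L" by (simp add: L_def)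
  then have "N \<le> 2 ^ L" using less_exp[of L] by linarith
  then have "h (2 ^ L) \<le> 1 / 2 * \<bar>ln (real (2 ^ L))\<bar>" using N[of "2 ^ L"] by simp
  also have "ln (real (2 ^ L)) = real L * ln 2" by (simp add: ln_realpow)
  also have "1 / 2 * \<bar>real L * ln 2\<bar> \<le> real L / 2"
    using ln_2_less_1 by (simp add: abs_mult mult_left_le)
  finally have h_le: "h (2 ^ L) \<le> real L / 2" .
  have "real (m ^ L) \<le> real (g (2 ^ L)) * real (m * L) powr h (2 ^ L) + 1"
  proof (rule query_lower_bound[OF L m, where B = "\<lambda>k. real (g k) * real (m * L) powr h k"])
    fix f :: "nat set \<Rightarrow> nat"
    assume "mono_on (Pow {..<m * L}) f" "submodular_on {..<m * L} f"
    moreover have "is_cycle (layered_graph L (m * L)) (transversal L (\<lambda>_. 0))"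
      using transversal_cycle[OF L] m by simp
    ultimately show "finds_optimal_cycle alg (m * L) (layered_graph L (m * L)) f
        (real (g (OPT (layered_graph L (m * L)) f))
          * real (m * L) powr h (OPT (layered_graph L (m * L)) f))"
      using L by (intro correct layered_graph_simple) auto
  qed
  then show False
    using allowed_queries_less[OF _ h_le r_def] L by (simp add: m_def)
qed

end
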